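(* Let $H_n$ denote the height of the random recursive tree $\mathcal{T}_n$ on $n$ vertices. Fix $\beta>1$ and define $J(\beta):=e\,\beta\ln\beta$. Then $$\lim_{n\to\infty}\frac{-\ln\mathbf{P}\left(H_n\ge\beta e\ln n\right)}{\ln n}=J(\beta).$$
   Context: Random recursive trees $(\mathcal{T}_n)_{n\ge1}$: $\mathcal{T}_1$ is a single root vertex $v_1$; given the tree $\mathcal{T}_n$ on vertices $v_1,\dots,v_n$, the tree $\mathcal{T}_{n+1}$ is obtained by adding a new vertex $v_{n+1}$ and attaching it by an edge to a vertex chosen uniformly at random among the $n$ vertices of $\mathcal{T}_n$ (independently of the past). The height is $H_n=\max_{1\le k\le n}\mathrm{dist}(v_1,v_k)$, where $\mathrm{dist}$ is the graph distance in $\mathcal{T}_n$. Here $e$ is Euler's number and $\ln$ the natural logarithm. *)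

theory Defs
  imports "HOL-Probability.Probability"
begin

text \<open>
  The tree on the vertices \<open>1, \<dots>, n\<close> (with root \<open>1\<close>) is represented by its set of
  undirected edges; its vertex set is always \<open>{1..n}\<close> and is not recorded separately.
\<close>

text \<open>
  Length of a shortest walk between two vertices.  The value is unspecified if the vertices
  are not connected, which does not occur for vertices of a tree.
\<close>

definition graph_dist :: "'v set set \<Rightarrow> 'v \<Rightarrow> 'v \<Rightarrow> nat" where
  "graph_dist E u v = (LEAST k. (u, v) \<in> {(x, y). {x, y} \<in> E} ^^ k)"

definition height :: "nat \<Rightarrow> nat set set \<Rightarrow> nat" where
  "height n E = Max ((\<lambda>k. graph_dist E 1 k) ` {1..n})"

text \<open>
  \<open>random_recursive_tree n\<close> is the law of the tree on \<open>n\<close> vertices.  In the recursive step the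
  new vertex is \<open>n + 2\<close> and its parent \<open>p\<close> is uniform on the \<open>n + 1\<close> existing vertices, whatever
  the present tree is.  The value at \<open>0\<close> is a dummy.
\<close>

fun random_recursive_tree :: "nat \<Rightarrow> nat set set pmf" where
  "random_recursive_tree 0 = return_pmf {}"
| "random_recursive_tree (Suc 0) = return_pmf {}"
| "random_recursive_tree (Suc (Suc n)) =
     do {
       E \<leftarrow> random_recursive_tree (Suc n);
       p \<leftarrow> pmf_of_set {1..Suc n};
       return_pmf (insert {p, Suc (Suc n)} E)
     }"

definition J :: "real \<Rightarrow> real" where
  "J \<beta> = exp 1 * \<beta> * ln \<beta>"

end

theory Submission
  imports Defs "HOL-Real_Asymp.Real_Asymp"
begin

text \<open>
  Write \<open>p v < v\<close> for the parent of the vertex \<open>v\<close>; the numbers \<open>p 2, \<dots>, p n\<close> are independent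
  and \<open>p v\<close> is uniform on \<open>{1, \<dots>, v - 1}\<close>.  A vertex of depth \<open>d\<close> is the same thing as a set
  \<open>S = {v\<^sub>1 < \<dots> < v\<^sub>d}\<close> whose elements, preceded by the root, form a line of descent, and a given
  \<open>S\<close> does so with probability \<open>weight S\<close>, the product of the \<open>1 / (v - 1)\<close> over \<open>v \<in> S\<close>.  So
  the height is at least \<open>h\<close> iff one of the events \<open>chain S\<close> with \<open>card S \<ge> h\<close> occurs
  (\<open>le_height_iff_chain\<close>), and its tail can be estimated by the first two moments of the number
  of chains in a suitable family.  Put \<open>y = \<beta> e\<close> and \<open>h = y ln n\<close>.

  For the upper bound on the probability, the expected number of chains of length at least
  \<open>h\<close> is at most \<open>y\<^sup>-\<^sup>h\<close> times the product of the factors \<open>1 + y / (v - 1)\<close>, hence at most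
  \<open>exp (y (1 + ln n) - h ln y)\<close>.  Since \<open>y ln y - y = J \<beta>\<close>, this is \<open>n powr (- J \<beta>)\<close> up to
  a constant factor (\<open>prob_height_ge_upper\<close>, \<open>rate_ge\<close>).

  For the lower bound a second moment argument is used, but not for all chains: the second
  moment of their number can be dominated by trees in which an unusually deep vertex appears
  early and then has very many descendants.  Only chains that climb at constant speed on the
  logarithmic scale are admitted: with a large constant \<open>A\<close>, every block \<open>{A\<^sup>j + 1, \<dots>, A\<^sup>j\<^sup>+\<^sup>1}\<close>, from a fixed \<open>j = i\<close>
  on, has to contain exactly \<open>q\<close> elements of the chain, where \<open>q\<close> is about \<open>y ln A\<close>
  (\<open>block_family\<close>).  Two chains that occur simultaneously share an initial segment and are
  disjoint afterwards.  As \<open>q \<ge> e ln A\<close>, the expected number of ways to branch off a given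
  admissible chain at a given place and to complete the branch is bounded by a constant
  (\<open>block_family_tail_weight_le\<close>), so the second moment exceeds the first by at most a factor
  of order \<open>ln n\<close>.  The expected number of admissible chains is at least
  \<open>(ln A)\<^sup>q / q!\<close> per block, up to a small error, which Stirling's estimate turns into
  \<open>A powr (- J \<beta> - \<epsilon>)\<close>; since there are about \<open>ln n / ln A\<close> blocks, the result is
  \<open>n powr (- J \<beta> - \<epsilon>)\<close> (\<open>eventually_rate_less\<close>).
\<close>

section \<open>Parents and depth in the random recursive tree\<close>

definition tree_of_parents :: "nat \<Rightarrow> (nat \<Rightarrow> nat) \<Rightarrow> nat set set" where
  "tree_of_parents n p = (\<lambda>v. {p v, v}) ` {2..n}"

definition parent_map_pmf :: "nat \<Rightarrow> (nat \<Rightarrow> nat) pmf" where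
  "parent_map_pmf n = Pi_pmf {2..n} 0 (\<lambda>v. pmf_of_set {1..<v})"

text \<open>
  The tree is built by drawing the parents one after the other; by independence they may as
  well be drawn all at once.
\<close>

lemma random_recursive_tree_eq_parent_map:
  "random_recursive_tree (Suc n) = map_pmf (tree_of_parents (Suc n)) (parent_map_pmf (Suc n))"
proof (induction n)
  case 0
  show ?case
    by (simp add: tree_of_parents_def parent_map_pmf_def)
next
  case (Suc n)
  have ins: "{2..Suc (Suc n)} = insert (Suc (Suc n)) {2..Suc n}" by auto
  have upd: "tree_of_parents (Suc (Suc n)) (f(Suc (Suc n) := p))
      = insert {p, Suc (Suc n)} (tree_of_parents (Suc n) f)" for f p
  proof -
    have "(\<lambda>v. {(f(Suc (Suc n) := p)) v, v}) ` {2..Suc n} = (\<lambda>v. {f v, v}) ` {2..Suc n}"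
      by (intro image_cong) auto
    thus ?thesis unfolding tree_of_parents_def ins image_insert by simp
  qed
  have "map_pmf (tree_of_parents (Suc (Suc n))) (parent_map_pmf (Suc (Suc n)))
      = pmf_of_set {1..<Suc (Suc n)} \<bind> (\<lambda>p. parent_map_pmf (Suc n) \<bind>
          (\<lambda>f. return_pmf (insert {p, Suc (Suc n)} (tree_of_parents (Suc n) f))))"
    unfolding parent_map_pmf_def ins
    by (subst Pi_pmf_insert')
      (simp_all add: map_pmf_def bind_assoc_pmf bind_return_pmf upd del: fun_upd_apply)
  also have "\<dots> = parent_map_pmf (Suc n) \<bind> (\<lambda>f. pmf_of_set {1..<Suc (Suc n)} \<bind>
          (\<lambda>p. return_pmf (insert {p, Suc (Suc n)} (tree_of_parents (Suc n) f))))"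
    by (rule bind_commute_pmf)
  also have "\<dots> = random_recursive_tree (Suc (Suc n))"
    unfolding random_recursive_tree.simps Suc
    by (simp add: map_pmf_def bind_assoc_pmf bind_return_pmf atLeastLessThanSuc_atLeastAtMost)
  finally show ?case by simp
qed

definition parent_map :: "nat \<Rightarrow> (nat \<Rightarrow> nat) \<Rightarrow> bool" where
  "parent_map n p \<longleftrightarrow> (\<forall>v\<in>{2..n}. 1 \<le> p v \<and> p v < v)"

lemma parent_map_if_mem_set_pmf:
  assumes "p \<in> set_pmf (parent_map_pmf n)"
  shows "parent_map n p"
proof -
  have "p v \<in> {1..<v}" if "v \<in> {2..n}" for v
  proof -
    have "p v \<in> set_pmf (pmf_of_set {1..<v})"
      using assms that unfolding parent_map_pmf_def
      by (subst (asm) set_Pi_pmf) (auto simp: PiE_dflt_def)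
    thus ?thesis using that by (subst (asm) set_pmf_of_set) auto
  qed
  thus ?thesis unfolding parent_map_def by auto
qed

text \<open>
  The test \<open>1 \<le> p v \<and> p v < v\<close> makes the recursion terminate for every function \<open>p\<close>.  It holds
  for the non-root vertices of a tree and fails at the root.
\<close>

fun depth :: "(nat \<Rightarrow> nat) \<Rightarrow> nat \<Rightarrow> nat" where
  "depth p v = (if 1 \<le> p v \<and> p v < v then Suc (depth p (p v)) else 0)"

declare depth.simps [simp del]

lemma depth_root [simp]: "depth p (Suc 0) = 0"
  by (subst depth.simps) auto

lemma depth_parent:
  assumes "parent_map n p" "v \<in> {2..n}"
  shows "depth p v = Suc (depth p (p v))"
  using assms by (subst depth.simps) (auto simp: parent_map_def)

text \<open>
  Following the parents gives a walk of length \<open>depth p v\<close>.  No walk is shorter, because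
  along an edge the depth changes by one.
\<close>

lemma graph_dist_eq_depth:
  assumes p: "parent_map n p" and v: "v \<in> {1..n}"
  shows "graph_dist (tree_of_parents n p) 1 v = depth p v"
proof -
  define R where "R = {(x, y). {x, y} \<in> tree_of_parents n p}"
  have walk: "(1, v) \<in> R ^^ depth p v"
    using v
  proof (induction v rule: less_induct)
    case (less v)
    show ?case
    proof (cases "v = 1")
      case False
      with less.prems have v2: "v \<in> {2..n}" by auto
      hence pv: "1 \<le> p v" "p v < v" using p by (auto simp: parent_map_def)
      have "(p v, v) \<in> R" using v2 by (auto simp: R_def tree_of_parents_def)
      moreover have "(1, p v) \<in> R ^^ depth p (p v)"
        using less.IH[of "p v"] pv v2 by auto
      ultimately show ?thesis
        unfolding depth_parent[OF p v2] by auto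
    qed auto
  qed
  have edge: "depth p y \<le> Suc (depth p x)" if "(x, y) \<in> R" for x y
  proof -
    from that obtain u where "{x, y} = {p u, u}" "u \<in> {2..n}"
      unfolding R_def tree_of_parents_def by blast
    moreover have "depth p u = Suc (depth p (p u))"
      using depth_parent[OF p \<open>u \<in> _\<close>] .
    ultimately show ?thesis unfolding doubleton_eq_iff by (metis le_Suc_eq order_refl)
  qed
  have lower: "depth p y \<le> depth p x + k" if "(x, y) \<in> R ^^ k" for x y k
    using that
  proof (induction k arbitrary: y)
    case (Suc k)
    then obtain z where "(x, z) \<in> R ^^ k" "(z, y) \<in> R" by auto
    thus ?case using Suc.IH[of z] edge[of z y] by auto
  qed auto
  show ?thesis
    unfolding graph_dist_def R_def[symmetric]
  proof (rule Least_equality)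
    show "depth p v \<le> k" if "(1, v) \<in> R ^^ k" for k
      using lower[OF that] by simp
  qed (rule walk)
qed

lemma le_height_iff:
  assumes "parent_map n p" "n \<ge> 1"
  shows "h \<le> height n (tree_of_parents n p) \<longleftrightarrow> (\<exists>v\<in>{1..n}. h \<le> depth p v)"
proof -
  have "height n (tree_of_parents n p) = Max (depth p ` {1..n})"
    unfolding height_def
    by (intro arg_cong[where f = Max] image_cong refl graph_dist_eq_depth[OF assms(1)])
  thus ?thesis using assms(2) by (simp add: Max_ge_iff)
qed

section \<open>Lines of descent\<close>

text \<open>
  The parent of each element of \<open>S\<close> is the preceding element of \<open>S\<close>, or the root \<open>1\<close> if there is
  none; the root itself is not listed in \<open>S\<close>.
\<close>

definition chain :: "nat set \<Rightarrow> (nat \<Rightarrow> nat) \<Rightarrow> bool" where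
  "chain S p \<longleftrightarrow> (\<forall>v\<in>S. p v = Max (insert 1 {u\<in>S. u < v}))"

lemma depth_in_chain:
  assumes p: "parent_map n p" and S: "S \<subseteq> {2..n}" "chain S p" and "v \<in> S"
  shows "depth p v = card {u\<in>S. u \<le> v}"
  using \<open>v \<in> S\<close>
proof (induction v rule: less_induct)
  case (less v)
  have fin: "finite S" using S finite_subset by blast
  have v2: "v \<in> {2..n}" using S less.prems by auto
  have pv: "p v = Max (insert 1 {u\<in>S. u < v})"
    using S less.prems by (auto simp: chain_def)
  have split: "{u\<in>S. u \<le> v} = insert v {u\<in>S. u < v}" using less.prems by auto
  have card: "card {u\<in>S. u \<le> v} = Suc (card {u\<in>S. u < v})"
    unfolding split using fin by (subst card_insert_disjoint) auto
  show ?case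
  proof (cases "{u\<in>S. u < v} = {}")
    case True
    hence "p v = 1" using pv by (metis Max_singleton)
    thus ?thesis unfolding depth_parent[OF p v2] card using True by simp
  next
    case False
    have "Max (insert 1 {u\<in>S. u < v}) = Max {u\<in>S. u < v}"
    proof -
      have "Max {u\<in>S. u < v} \<in> {u\<in>S. u < v}"
        using False fin by (intro Max_in) auto
      hence "Max {u\<in>S. u < v} \<ge> 1" using S by auto
      thus ?thesis using False fin by (subst Max_insert) (auto simp: max_def)
    qed
    moreover have "Max {u\<in>S. u < v} \<in> {u\<in>S. u < v}"
      using False fin by (intro Max_in) auto
    ultimately have mem: "p v \<in> S" "p v < v" using pv by auto
    have "{u\<in>S. u \<le> p v} = {u\<in>S. u < v}"
    proof -
      have "u \<le> p v" if "u \<in> S" "u < v" for u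
        unfolding pv using that fin by (intro Max_ge) auto
      thus ?thesis using mem by auto
    qed
    thus ?thesis
      unfolding depth_parent[OF p v2] card using less.IH[OF mem(2,1)] by simp
  qed
qed

text \<open>
  The chain of \<open>v\<close> consists of \<open>v\<close> and its ancestors other than the root.  The last conjunct says
  that it ends in \<open>v\<close>, in a form that also covers the empty chain of the root; it is what allows
  a child of \<open>v\<close> to be appended.
\<close>

lemma ancestor_chain:
  assumes p: "parent_map n p" and "v \<in> {1..n}"
  shows "\<exists>S\<subseteq>{2..v}. chain S p \<and> card S = depth p v \<and> Max (insert 1 S) = v"
  using assms(2)
proof (induction v rule: less_induct)
  case (less v)
  show ?case
  proof (cases "v = 1")
    case True
    thus ?thesis by (intro exI[of _ "{}"]) (auto simp: chain_def)
  next
    case False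
    with less.prems have v2: "v \<in> {2..n}" by auto
    hence pv: "1 \<le> p v" "p v < v" using p by (auto simp: parent_map_def)
    then obtain S where S: "S \<subseteq> {2..p v}" "chain S p" "card S = depth p (p v)"
      "Max (insert 1 S) = p v"
      using less.IH[of "p v"] v2 by auto
    have fin: "finite S" using S finite_subset by blast
    have below: "{u\<in>insert v S. u < w} = {u\<in>S. u < w}" if "w \<le> v" for w
      using that by auto
    have all: "{u\<in>S. u < v} = S" using S pv by fastforce
    have vS: "v \<notin> S" using S pv by fastforce
    have "chain (insert v S) p"
      unfolding chain_def
    proof
      fix w assume w: "w \<in> insert v S"
      show "p w = Max (insert 1 {u \<in> insert v S. u < w})"
      proof (cases "w = v")
        case True
        show ?thesis unfolding True below[OF order_refl] all by (rule S(4)[symmetric])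
      next
        case False
        with w have "w \<in> S" by auto
        hence "w \<le> v" using S(1) pv by fastforce
        show ?thesis
          unfolding below[OF \<open>w \<le> v\<close>] using S(2) \<open>w \<in> S\<close> unfolding chain_def by blast
      qed
    qed
    moreover have "card (insert v S) = depth p v"
      using S(3) vS fin depth_parent[OF p v2] by simp
    moreover have "Max (insert 1 (insert v S)) = v"
    proof (rule Max_eqI)
      show "u \<le> v" if "u \<in> insert 1 (insert v S)" for u
        using that S(1) pv by fastforce
    qed (use fin in auto)
    moreover have "insert v S \<subseteq> {2..v}" using S(1) v2 pv by fastforce
    ultimately show ?thesis by (intro exI[of _ "insert v S"]) auto
  qed
qed

lemma le_height_iff_chain:
  assumes p: "parent_map n p" and n: "n \<ge> 1"
  shows "h \<le> height n (tree_of_parents n p) \<longleftrightarrow> (\<exists>S\<subseteq>{2..n}. chain S p \<and> h \<le> card S)"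
proof
  assume "h \<le> height n (tree_of_parents n p)"
  then obtain v where v: "v \<in> {1..n}" "h \<le> depth p v"
    using le_height_iff[OF p n] by auto
  from ancestor_chain[OF p v(1)] obtain S
    where S: "S \<subseteq> {2..v}" "chain S p" "card S = depth p v" by blast
  have "S \<subseteq> {2..n}" using S(1) v(1) by auto
  thus "\<exists>S\<subseteq>{2..n}. chain S p \<and> h \<le> card S" using S v(2) by auto
next
  assume "\<exists>S\<subseteq>{2..n}. chain S p \<and> h \<le> card S"
  then obtain S where S: "S \<subseteq> {2..n}" "chain S p" "h \<le> card S" by auto
  have fin: "finite S" using S finite_subset by blast
  show "h \<le> height n (tree_of_parents n p)"
  proof (cases "S = {}")
    case False
    hence M: "Max S \<in> S" using fin by auto
    have "{u\<in>S. u \<le> Max S} = S" using fin by auto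
    hence "depth p (Max S) = card S"
      using depth_in_chain[OF p S(1,2) M] by simp
    moreover have "Max S \<in> {1..n}" using S(1) M by auto
    ultimately show ?thesis unfolding le_height_iff[OF p n] using S(3) by (intro bexI) auto
  qed (use S in auto)
qed

text \<open>
  The probability that \<open>S\<close> is a chain, see \<open>prob_chain\<close> below.
\<close>

definition weight :: "nat set \<Rightarrow> real" where
  "weight S = (\<Prod>v\<in>S. 1 / real (v - 1))"

lemma weight_nonneg [simp]: "weight S \<ge> 0"
  unfolding weight_def by (intro prod_nonneg) auto

lemma prob_parents:
  assumes "S \<subseteq> {2..n}"
  shows "measure_pmf.prob (parent_map_pmf n) {p. \<forall>v\<in>S. p v = f v}
       = (\<Prod>v\<in>S. if f v \<in> {1..<v} then 1 / real (v - 1) else 0)"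
proof -
  define B where "B v = (if v \<in> S then {f v} else UNIV)" for v
  have "{p. \<forall>v\<in>S. p v = f v} = Pi {2..n} B"
    using assms by (auto simp: B_def Pi_def)
  hence "measure_pmf.prob (parent_map_pmf n) {p. \<forall>v\<in>S. p v = f v}
      = (\<Prod>v\<in>{2..n}. measure_pmf.prob (pmf_of_set {1..<v}) (B v))"
    unfolding parent_map_pmf_def by (simp add: measure_Pi_pmf_Pi)
  also have "\<dots> = (\<Prod>v\<in>S. measure_pmf.prob (pmf_of_set {1..<v}) (B v))"
    using assms by (intro prod.mono_neutral_right) (auto simp: B_def)
  also have "\<dots> = (\<Prod>v\<in>S. if f v \<in> {1..<v} then 1 / real (v - 1) else 0)"
  proof (rule prod.cong)
    fix v assume v: "v \<in> S"
    hence "v \<ge> 2" using assms by auto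
    thus "measure_pmf.prob (pmf_of_set {1..<v}) (B v)
        = (if f v \<in> {1..<v} then 1 / real (v - 1) else 0)"
      using v by (auto simp: B_def measure_pmf_single pmf_of_set indicator_def)
  qed auto
  finally show ?thesis .
qed

text \<open>
  A chain prescribes the parents of its elements, and each prescribed value is one of the
  \<open>v - 1\<close> possible ones.
\<close>

lemma prob_chain:
  assumes "S \<subseteq> {2..n}"
  shows "measure_pmf.prob (parent_map_pmf n) {p. chain S p} = weight S"
proof -
  have fin: "finite S" using assms finite_subset by blast
  have "Max (insert 1 {u\<in>S. u < v}) \<in> {1..<v}" if "v \<in> S" for v
  proof -
    have "Max (insert 1 {u\<in>S. u < v}) \<in> insert 1 {u\<in>S. u < v}"
      using fin by (intro Max_in) auto
    moreover have "2 \<le> v" using assms that by auto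
    ultimately show ?thesis using assms by fastforce
  qed
  thus ?thesis
    unfolding chain_def prob_parents[OF assms] weight_def by (intro prod.cong) auto
qed

text \<open>
  Both chains list the ancestors of the common element \<open>w\<close>: its parent is read off from either
  of them, so it is again a common element (or the root), and one descends.
\<close>

lemma chains_agree_below:
  assumes "chain S p" "chain S' p" "S \<subseteq> {2..n}" "S' \<subseteq> {2..n}" "w \<in> S" "w \<in> S'"
  shows "{u\<in>S. u < w} = {u\<in>S'. u < w}"
  using assms(5,6)
proof (induction w rule: less_induct)
  case (less w)
  have fin: "finite S" "finite S'" using assms finite_subset by blast+
  define x where "x = p w"
  have x: "x = Max (insert 1 {u\<in>S. u < w})" "x = Max (insert 1 {u\<in>S'. u < w})"
    using assms less.prems by (auto simp: chain_def x_def)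
  have "x \<in> insert 1 {u\<in>S. u < w}"
    unfolding x(1) using fin by (intro Max_in) auto
  moreover have "x \<in> insert 1 {u\<in>S'. u < w}"
    unfolding x(2) using fin by (intro Max_in) auto
  ultimately have x_in: "x = 1 \<or> x \<in> S \<and> x \<in> S' \<and> x < w" by auto
  have le: "u \<le> x" if "u \<in> S \<and> u < w \<or> u \<in> S' \<and> u < w" for u
    using that
  proof
    assume "u \<in> S \<and> u < w"
    thus ?thesis unfolding x(1) using fin by (intro Max_ge) auto
  next
    assume "u \<in> S' \<and> u < w"
    thus ?thesis unfolding x(2) using fin by (intro Max_ge) auto
  qed
  show ?case
  proof (cases "x = 1")
    case True
    have "u \<ge> 2" if "u \<in> S \<or> u \<in> S'" for u using that assms by auto
    with le True show ?thesis by fastforce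
  next
    case False
    with x_in have x': "x \<in> S" "x \<in> S'" "x < w" by auto
    hence "{u\<in>S. u < x} = {u\<in>S'. u < x}" using less.IH by blast
    hence "u \<in> S \<longleftrightarrow> u \<in> S'" if "u < x" for u using that by blast
    hence "u \<in> S \<longleftrightarrow> u \<in> S'" if "u \<le> x" for u
      using that x' by (cases "u = x") auto
    with le show ?thesis by blast
  qed
qed

section \<open>Sums over subsets and the second moment method\<close>

text \<open>
  The left-hand side is the expansion of the product of the factors \<open>1 + z w a\<close>.
\<close>

lemma sum_subsets_prod_le_exp:
  fixes w :: "'a \<Rightarrow> real"
  assumes "finite A" "\<And>a. a \<in> A \<Longrightarrow> w a \<ge> 0" "z \<ge> 0"
  shows "(\<Sum>R\<in>Pow A. z ^ card R * prod w R) \<le> exp (z * sum w A)"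
proof -
  have "(\<Sum>R\<in>Pow A. z ^ card R * prod w R) = (\<Sum>R\<in>Pow A. (\<Prod>a\<in>R. z * w a) * (\<Prod>a\<in>A-R. 1))"
    by (simp add: prod.distrib)
  also have "\<dots> = (\<Prod>a\<in>A. z * w a + 1)"
    using assms(1) by (rule prod_add[symmetric])
  also have "\<dots> \<le> (\<Prod>a\<in>A. exp (z * w a))"
    using assms by (intro prod_mono conjI) (auto simp: add.commute[of _ 1] intro: exp_ge_add_one_self add_nonneg_nonneg)
  also have "\<dots> = exp (z * sum w A)"
    using assms(1) by (simp add: exp_sum sum_distrib_left)
  finally show ?thesis .
qed

text \<open>
  Markov's inequality in exponential form: a set with at least \<open>k\<close> elements is counted with
  the additional factor \<open>z ^ (card R - k) \<ge> 1\<close>.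
\<close>

lemma sum_large_subsets_prod_le:
  fixes w :: "'a \<Rightarrow> real"
  assumes "finite A" "\<And>a. a \<in> A \<Longrightarrow> w a \<ge> 0" "z \<ge> 1" "\<And>R. R \<in> \<R> \<Longrightarrow> R \<subseteq> A \<and> k \<le> card R"
  shows "(\<Sum>R\<in>\<R>. prod w R) \<le> exp (z * sum w A) / z ^ k"
proof -
  have nn: "prod w R \<ge> 0" if "R \<subseteq> A" for R
    using that assms(2) by (intro prod_nonneg) auto
  have "z ^ k * (\<Sum>R\<in>\<R>. prod w R) = (\<Sum>R\<in>\<R>. z ^ k * prod w R)"
    by (rule sum_distrib_left)
  also have "\<dots> \<le> (\<Sum>R\<in>\<R>. z ^ card R * prod w R)"
    using assms(3,4) nn by (intro sum_mono mult_right_mono power_increasing) auto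
  also have "\<dots> \<le> (\<Sum>R\<in>Pow A. z ^ card R * prod w R)"
    using assms nn by (intro sum_mono2) auto
  also have "\<dots> \<le> exp (z * sum w A)"
    using assms by (intro sum_subsets_prod_le_exp) auto
  finally show ?thesis using assms(3) by (simp add: field_simps)
qed

text \<open>
  A lower bound for elementary symmetric polynomials.  When \<open>k\<close> different elements are chosen
  successively, at each step the elements already used reduce the total weight by at most
  \<open>k \<delta>\<close>, and every set arises from \<open>fact k\<close> orderings.
\<close>

lemma sum_card_subsets_prod_ge:
  fixes w :: "'a \<Rightarrow> real"
  assumes A: "finite A" and w: "\<And>a. a \<in> A \<Longrightarrow> 0 \<le> w a \<and> w a \<le> \<delta>" and "real k * \<delta> \<le> sum w A"
    and "\<delta> \<ge> 0"
  shows "(\<Sum>R | R \<subseteq> A \<and> card R = k. prod w R) \<ge> (sum w A - real k * \<delta>) ^ k / fact k"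
  using assms(3)
proof -
  define e where "e j = (\<Sum>R | R \<subseteq> A \<and> card R = j. prod w R)" for j
  define c where "c = sum w A - real k * \<delta>"
  have c: "c \<ge> 0" using assms(3) by (simp add: c_def)
  have nn: "prod w R \<ge> 0" if "R \<subseteq> A" for R
    using that w by (intro prod_nonneg) auto
  have step: "real (Suc j) * e (Suc j) \<ge> e j * c" if "j \<le> k" for j
  proof -
    \<comment> \<open>Pairs of a set of size \<open>j + 1\<close> and one of its elements are counted in two ways.\<close>
    have bij: "bij_betw (\<lambda>(R, v). (insert v R, v)) (SIGMA R:{R. R \<subseteq> A \<and> card R = j}. A - R)
       (SIGMA R:{R. R \<subseteq> A \<and> card R = Suc j}. R)"
    proof (rule bij_betw_byWitness[where f' = "\<lambda>(R, v). (R - {v}, v)"])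
      show "(\<lambda>(R, v). (insert v R, v)) ` (SIGMA R:{R. R \<subseteq> A \<and> card R = j}. A - R)
         \<subseteq> (SIGMA R:{R. R \<subseteq> A \<and> card R = Suc j}. R)"
        using A finite_subset by (fastforce simp: card_insert_disjoint)
      show "(\<lambda>(R, v). (R - {v}, v)) ` (SIGMA R:{R. R \<subseteq> A \<and> card R = Suc j}. R)
         \<subseteq> (SIGMA R:{R. R \<subseteq> A \<and> card R = j}. A - R)"
        using A finite_subset by auto
    qed auto
    have fin: "finite {R. R \<subseteq> A \<and> card R = i}" for i using A by simp
    have finR: "finite R" if "R \<subseteq> A" for R using A that finite_subset by blast
    have "real (Suc j) * e (Suc j) = (\<Sum>R | R \<subseteq> A \<and> card R = Suc j. \<Sum>v\<in>R. prod w R)"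
      unfolding e_def sum_distrib_left by (intro sum.cong) auto
    also have "\<dots> = (\<Sum>(R, v)\<in>(SIGMA R:{R. R \<subseteq> A \<and> card R = Suc j}. R). prod w R)"
      using fin finR by (subst sum.Sigma) auto
    also have "\<dots> = (\<Sum>(R, v)\<in>(SIGMA R:{R. R \<subseteq> A \<and> card R = j}. A - R). prod w (insert v R))"
      by (subst sum.reindex_bij_betw[OF bij, symmetric]) (auto intro!: sum.cong)
    also have "\<dots> = (\<Sum>R | R \<subseteq> A \<and> card R = j. \<Sum>v\<in>A - R. prod w (insert v R))"
      using fin A by (subst sum.Sigma) auto
    also have "\<dots> = (\<Sum>R | R \<subseteq> A \<and> card R = j. prod w R * sum w (A - R))"
      unfolding sum_distrib_left using finR
      by (intro sum.cong) (auto simp: mult.commute)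
    also have "\<dots> \<ge> (\<Sum>R | R \<subseteq> A \<and> card R = j. prod w R * c)"
    proof (intro sum_mono mult_left_mono)
      fix R assume R: "R \<in> {R. R \<subseteq> A \<and> card R = j}"
      have "sum w R \<le> real (card R) * \<delta>"
        using R w by (intro sum_bounded_above) auto
      also have "\<dots> \<le> real k * \<delta>" using R that \<open>\<delta> \<ge> 0\<close> by (intro mult_right_mono) auto
      finally show "c \<le> sum w (A - R)"
        using R A by (simp add: sum_diff c_def finR)
    qed (use nn in auto)
    finally show ?thesis by (simp add: e_def sum_distrib_right)
  qed
  have "e j \<ge> c ^ j / fact j" if "j \<le> k" for j
    using that
  proof (induction j)
    case 0
    have "{R. R \<subseteq> A \<and> card R = 0} = {{}}" using A finite_subset by fastforce
    thus ?case by (simp add: e_def)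
  next
    case (Suc j)
    have "c ^ Suc j / fact (Suc j) = c ^ j / fact j * c / real (Suc j)"
      by (simp add: field_simps)
    also have "\<dots> \<le> e j * c / real (Suc j)"
      using Suc c by (intro divide_right_mono mult_right_mono) auto
    also have "\<dots> \<le> e (Suc j)"
      using step[of j] Suc.prems by (simp add: field_simps)
    finally show ?case .
  qed
  from this[of k] show ?thesis by (simp add: e_def c_def)
qed

text \<open>
  Let \<open>N\<close> be the number of events that occur.  Then \<open>2 x - x\<^sup>2 \<le> 1\<close> with \<open>x = N / B\<close> bounds the
  indicator of \<open>N > 0\<close> from below, and the hypothesis says that the second moment of \<open>N\<close> is at
  most \<open>B\<close> times the first.
\<close>

lemma prob_union_ge_second_moment:
  fixes M :: "'a pmf" and E :: "'i \<Rightarrow> 'a set"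
  assumes "finite I" "B > 0"
    and "\<And>i. i \<in> I \<Longrightarrow> (\<Sum>j\<in>I. measure_pmf.prob M (E i \<inter> E j)) \<le> B * measure_pmf.prob M (E i)"
  shows "measure_pmf.prob M (\<Union>i\<in>I. E i) \<ge> (\<Sum>i\<in>I. measure_pmf.prob M (E i)) / B"
proof -
  define N where "N x = (\<Sum>i\<in>I. indicator (E i) x :: real)" for x
  define m where "m = (\<Sum>i\<in>I. measure_pmf.prob M (E i))"
  have int: "integrable (measure_pmf M) (indicator X :: _ \<Rightarrow> real)" for X
    by (simp add: measure_pmf.integrable_const_bound[where B = 1])
  have intN: "integrable (measure_pmf M) N"
    unfolding N_def by (intro Bochner_Integration.integrable_sum int)
  have N2: "N x ^ 2 = (\<Sum>i\<in>I. \<Sum>j\<in>I. indicator (E i \<inter> E j) x)" for x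
    by (simp add: N_def power2_eq_square sum_product indicator_inter_arith)
  have intN2: "integrable (measure_pmf M) (\<lambda>x. N x ^ 2)"
    unfolding N2 by (intro Bochner_Integration.integrable_sum int)
  have EN: "measure_pmf.expectation M N = m"
    unfolding N_def m_def by (subst Bochner_Integration.integral_sum) (auto intro: int)
  have EN2: "measure_pmf.expectation M (\<lambda>x. N x ^ 2) \<le> B * m"
  proof -
    have "measure_pmf.expectation M (\<lambda>x. N x ^ 2)
        = (\<Sum>i\<in>I. \<Sum>j\<in>I. measure_pmf.prob M (E i \<inter> E j))"
      unfolding N2 using int
      by (subst Bochner_Integration.integral_sum; (subst Bochner_Integration.integral_sum)?)
         (auto intro!: Bochner_Integration.integrable_sum)
    also have "\<dots> \<le> (\<Sum>i\<in>I. B * measure_pmf.prob M (E i))"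
      using assms(3) by (intro sum_mono) auto
    finally show ?thesis by (simp add: m_def sum_distrib_left)
  qed
  have "2 / B * N x - 1 / B ^ 2 * N x ^ 2 \<le> indicator (\<Union>i\<in>I. E i) x" for x
  proof (cases "x \<in> (\<Union>i\<in>I. E i)")
    case True
    have "0 \<le> (N x / B - 1) ^ 2" by simp
    thus ?thesis using True \<open>B > 0\<close> by (simp add: power2_diff power_divide)
  next
    case False
    hence "N x = 0" by (auto simp: N_def)
    thus ?thesis by simp
  qed
  hence "measure_pmf.expectation M (\<lambda>x. 2 / B * N x - 1 / B ^ 2 * N x ^ 2)
      \<le> measure_pmf.expectation M (indicator (\<Union>i\<in>I. E i))"
    using intN intN2 int by (intro integral_mono) auto
  also have "measure_pmf.expectation M (\<lambda>x. 2 / B * N x - 1 / B ^ 2 * N x ^ 2)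
      = 2 / B * m - 1 / B ^ 2 * measure_pmf.expectation M (\<lambda>x. N x ^ 2)"
    using intN intN2 by (simp add: EN)
  finally have "2 / B * m - 1 / B ^ 2 * measure_pmf.expectation M (\<lambda>x. N x ^ 2)
      \<le> measure_pmf.prob M (\<Union>i\<in>I. E i)" by simp
  moreover have "1 / B ^ 2 * measure_pmf.expectation M (\<lambda>x. N x ^ 2) \<le> 1 / B ^ 2 * (B * m)"
    using EN2 by (intro mult_left_mono) auto
  moreover have "1 / B ^ 2 * (B * m) = m / B" using \<open>B > 0\<close> by (simp add: power2_eq_square)
  ultimately show ?thesis by (simp add: m_def)
qed

section \<open>Correlation of two chains\<close>

text \<open>
  If both chains occur then the parents of all elements of \<open>S \<union> S'\<close> are determined.
\<close>

lemma prob_two_chains_le: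
  assumes S: "S \<subseteq> {2..n}" and S': "S' \<subseteq> {2..n}"
  shows "measure_pmf.prob (parent_map_pmf n) ({p. chain S p} \<inter> {p. chain S' p})
       \<le> weight S * weight (S' - S)"
proof -
  define f where "f v = (if v \<in> S then Max (insert 1 {u\<in>S. u < v}) else Max (insert 1 {u\<in>S'. u < v}))" for v
  have fin: "finite S" "finite S'" using assms finite_subset by blast+
  have "measure_pmf.prob (parent_map_pmf n) ({p. chain S p} \<inter> {p. chain S' p})
     \<le> measure_pmf.prob (parent_map_pmf n) {p. \<forall>v\<in>S \<union> S'. p v = f v}"
    by (intro measure_pmf.finite_measure_mono) (auto simp: chain_def f_def)
  also have "\<dots> = (\<Prod>v\<in>S \<union> S'. if f v \<in> {1..<v} then 1 / real (v - 1) else 0)"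
    using assms by (intro prob_parents) auto
  also have "\<dots> \<le> weight (S \<union> S')"
    unfolding weight_def by (intro prod_mono) auto
  also have "\<dots> = weight S * weight (S' - S)"
    unfolding weight_def using fin
    by (subst Un_Diff_cancel[symmetric], subst prod.union_disjoint) auto
  finally show ?thesis .
qed

lemma common_part_is_initial_segment:
  assumes S: "S \<subseteq> {2..n}" "chain S p" and S': "S' \<subseteq> {2..n}" "chain S' p"
  defines "t \<equiv> Max (insert 1 (S \<inter> S'))"
  shows "S \<inter> S' = {u\<in>S. u \<le> t}" "S \<inter> S' = {u\<in>S'. u \<le> t}" "t \<in> insert 1 S"
proof -
  have fin: "finite (S \<inter> S')" using S(1) finite_subset by blast
  have t_in: "t \<in> insert 1 (S \<inter> S')" unfolding t_def using fin by (intro Max_in) auto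
  thus "t \<in> insert 1 S" by auto
  have le: "u \<le> t" if "u \<in> S \<inter> S'" for u unfolding t_def using fin that by (intro Max_ge) auto
  have "u \<in> S \<longleftrightarrow> u \<in> S'" if "u \<le> t" for u
  proof (cases "t \<in> S \<inter> S'")
    case True
    hence below: "{u\<in>S. u < t} = {u\<in>S'. u < t}"
      using chains_agree_below[OF S(2) S'(2) S(1) S'(1)] by blast
    show ?thesis
    proof (cases "u = t")
      case False
      hence "u < t" using that by simp
      thus ?thesis using below by blast
    qed (use True in blast)
  next
    case False
    hence "t = 1" using t_in by blast
    hence "u < 2" using that by simp
    hence "u \<notin> {2..n}" by simp
    thus ?thesis using S(1) S'(1) by blast
  qed
  with le show "S \<inter> S' = {u\<in>S. u \<le> t}" "S \<inter> S' = {u\<in>S'. u \<le> t}" by blast+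
qed

text \<open>
  A chain \<open>S'\<close> compatible with \<open>S\<close> is determined by its last common element \<open>t\<close> with \<open>S\<close> (or the
  root) and by the set \<open>R = S' - S\<close>, which lies beyond \<open>t\<close> and has as many elements as the part of
  \<open>S\<close> beyond \<open>t\<close>.  There are \<open>d + 1\<close> choices of \<open>t\<close>, and \<open>B\<close> bounds the total weight of the sets \<open>R\<close>
  for each of them.
\<close>

lemma sum_prob_two_chains_le:
  assumes V: "V \<subseteq> {2..n}" and F: "\<And>S'. S' \<in> F \<Longrightarrow> S' \<subseteq> V \<and> card S' = d" and S: "S \<in> F"
    and B: "\<And>t. t \<in> insert 1 S \<Longrightarrow>
      (\<Sum>R | R \<subseteq> {v\<in>V. t < v} \<and> card R = card {u\<in>S. t < u}. weight R) \<le> B"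
  shows "(\<Sum>S'\<in>F. measure_pmf.prob (parent_map_pmf n) ({p. chain S p} \<inter> {p. chain S' p}))
       \<le> (real (d + 1) * B) * measure_pmf.prob (parent_map_pmf n) {p. chain S p}"
proof -
  define P where "P X = measure_pmf.prob (parent_map_pmf n) X" for X
  define C where "C = {S'\<in>F. \<exists>p. chain S p \<and> chain S' p}"
  define t where "t S' = Max (insert 1 (S \<inter> S'))" for S'
  define G where "G t = {R. R \<subseteq> {v\<in>V. t < v} \<and> card R = card {u\<in>S. t < u}}" for t
  have finV: "finite V" using V finite_subset by blast
  have finF: "finite F" by (rule finite_subset[of _ "Pow V"]) (use F finV in auto)
  have finS: "finite S'" if "S' \<in> F" for S' using F[OF that] finV finite_subset by blast
  have range: "S' \<subseteq> {2..n}" if "S' \<in> F" for S' using F[OF that] V by blast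
  have finG: "finite (G t)" for t
    unfolding G_def by (rule finite_subset[of _ "Pow V"]) (use finV in auto)
  have seg: "S \<inter> S' = {u\<in>S. u \<le> t S'}" "S \<inter> S' = {u\<in>S'. u \<le> t S'}" "t S' \<in> insert 1 S"
    if "S' \<in> C" for S'
  proof -
    from that obtain p where p: "chain S p" "chain S' p" and S': "S' \<in> F" by (auto simp: C_def)
    show "S \<inter> S' = {u\<in>S. u \<le> t S'}" "S \<inter> S' = {u\<in>S'. u \<le> t S'}" "t S' \<in> insert 1 S"
      unfolding t_def using common_part_is_initial_segment[OF range[OF S] p(1) range[OF S'] p(2)]
      by blast+
  qed
  have inj: "inj_on (\<lambda>S'. (t S', S' - S)) C"
  proof (rule inj_onI)
    fix S1 S2 assume *: "S1 \<in> C" "S2 \<in> C" "(t S1, S1 - S) = (t S2, S2 - S)"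
    have "S \<inter> S1 = S \<inter> S2" using seg(1)[OF *(1)] seg(1)[OF *(2)] *(3) by simp
    with * show "S1 = S2" by blast
  qed
  have maps: "(\<lambda>S'. (t S', S' - S)) ` C \<subseteq> Sigma (insert 1 S) G"
  proof (rule image_subsetI)
    fix S' assume C: "S' \<in> C"
    hence S'F: "S' \<in> F" by (simp add: C_def)
    have "u \<in> S \<inter> S' \<longleftrightarrow> u \<in> S \<and> u \<le> t S'" "u \<in> S \<inter> S' \<longleftrightarrow> u \<in> S' \<and> u \<le> t S'" for u
      using seg(1,2)[OF C] by blast+
    hence "S' - S = {u\<in>S'. t S' < u}" "S - S' = {u\<in>S. t S' < u}"
      unfolding not_le[symmetric] by blast+
    moreover have "card (S' - S) = card (S - S')"
      using F[OF S] F[OF S'F] finS[OF S] finS[OF S'F]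
      by (simp add: card_Diff_subset_Int Int_commute)
    ultimately have "S' - S \<in> G (t S')" using F[OF S'F] by (auto simp: G_def)
    thus "(t S', S' - S) \<in> Sigma (insert 1 S) G" using seg(3)[OF C] by blast
  qed
  have "(\<Sum>S'\<in>F. P ({p. chain S p} \<inter> {p. chain S' p}))
      = (\<Sum>S'\<in>C. P ({p. chain S p} \<inter> {p. chain S' p}))"
  proof (rule sum.mono_neutral_right)
    show "\<forall>S'\<in>F - C. P ({p. chain S p} \<inter> {p. chain S' p}) = 0"
    proof
      fix S' assume "S' \<in> F - C"
      hence "{p. chain S p} \<inter> {p. chain S' p} = {}" by (auto simp: C_def)
      thus "P ({p. chain S p} \<inter> {p. chain S' p}) = 0" by (simp add: P_def)
    qed
  qed (use finF in \<open>auto simp: C_def\<close>)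
  also have "\<dots> \<le> (\<Sum>S'\<in>C. weight S * weight (S' - S))"
    unfolding P_def using range[OF S] range by (intro sum_mono prob_two_chains_le) (auto simp: C_def)
  also have "\<dots> = weight S * (\<Sum>S'\<in>C. weight (S' - S))"
    by (simp add: sum_distrib_left)
  also have "(\<Sum>S'\<in>C. weight (S' - S)) = (\<Sum>(t, R)\<in>(\<lambda>S'. (t S', S' - S)) ` C. weight R)"
    by (subst sum.reindex[OF inj]) simp
  also have "\<dots> \<le> (\<Sum>(t, R)\<in>Sigma (insert 1 S) G. weight R)"
    using finS[OF S] finG by (intro sum_mono2 maps) auto
  also have "\<dots> = (\<Sum>t\<in>insert 1 S. \<Sum>R\<in>G t. weight R)"
    using finS[OF S] finG by (subst sum.Sigma) auto
  also have "\<dots> \<le> (\<Sum>t\<in>insert 1 S. B)"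
    unfolding G_def by (intro sum_mono B)
  also have "\<dots> = real (d + 1) * B"
  proof -
    have "1 \<notin> S" using range[OF S] by auto
    thus ?thesis using F[OF S] finS[OF S] by simp
  qed
  finally have "(\<Sum>S'\<in>F. P ({p. chain S p} \<inter> {p. chain S' p})) \<le> weight S * (real (d + 1) * B)"
    by (simp add: mult_left_mono)
  thus ?thesis
    unfolding P_def prob_chain[OF range[OF S]] by (simp only: mult.commute)
qed

section \<open>Logarithmic estimates\<close>

text \<open>
  The induction step rests on \<open>e \<le> (1 + 1 / q) ^ (q + 1)\<close>.
\<close>

lemma fact_le_stirling:
  assumes "q \<ge> 1"
  shows "fact q \<le> exp 1 * real q * (real q / exp 1) ^ q"
  using assms
proof (induction q rule: nat_induct_at_least)
  case base
  show ?case by simp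
next
  case (Suc q)
  have q: "real q > 0" using Suc.hyps by simp
  have "1 \<le> real (Suc q) * ln (1 + 1 / real q)"
  proof -
    have "ln (real q / real (Suc q)) \<le> real q / real (Suc q) - 1"
      using q by (intro ln_le_minus_one) auto
    moreover have "ln (real q / real (Suc q)) = - ln (1 + 1 / real q)"
      using q by (subst ln_inverse[symmetric]) (auto simp: field_simps)
    moreover have "real q / real (Suc q) - 1 = - 1 / real (Suc q)" by (simp add: field_simps)
    ultimately have "1 / real (Suc q) \<le> ln (1 + 1 / real q)" by simp
    thus ?thesis by (simp add: field_simps)
  qed
  hence "exp 1 \<le> exp (real (Suc q) * ln (1 + 1 / real q))" by simp
  also have "\<dots> = (1 + 1 / real q) ^ Suc q"
    using q by (subst exp_of_nat_mult) (simp add: add_pos_pos)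
  also have "\<dots> = real (Suc q) ^ Suc q / real q ^ Suc q"
    using q by (subst power_divide[symmetric]) (simp add: field_simps)
  finally have *: "exp 1 * real q ^ Suc q \<le> real (Suc q) ^ Suc q"
    using q by (simp add: field_simps)
  have "fact (Suc q) \<le> real (Suc q) * (exp 1 * real q * (real q / exp 1) ^ q)"
    using Suc.IH by (simp add: mult_left_mono)
  also have "\<dots> = real (Suc q) * (exp 1 * real q ^ Suc q) / exp 1 ^ q"
    by (simp add: power_divide)
  also have "\<dots> \<le> real (Suc q) * (real (Suc q) ^ Suc q) / exp 1 ^ q"
    using * by (intro divide_right_mono mult_left_mono) auto
  also have "\<dots> = exp 1 * real (Suc q) * (real (Suc q) / exp 1) ^ Suc q"
    by (simp add: power_divide)
  finally show ?case .
qed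

lemma sum_inverse_le_ln:
  assumes "0 < a" "a \<le> b"
  shows "(\<Sum>v\<in>{Suc a<..Suc b}. 1 / real (v - 1)) \<le> ln (real b / real a)"
  using assms(2)
proof (induction b rule: dec_induct)
  case base
  show ?case using assms(1) by simp
next
  case (step b)
  have "{Suc a<..Suc (Suc b)} = insert (Suc (Suc b)) {Suc a<..Suc b}" using step by auto
  hence "(\<Sum>v\<in>{Suc a<..Suc (Suc b)}. 1 / real (v - 1))
      = 1 / real (Suc b) + (\<Sum>v\<in>{Suc a<..Suc b}. 1 / real (v - 1))" by simp
  also have "\<dots> \<le> 1 / real (Suc b) + ln (real b / real a)" using step by simp
  also have "ln (real b / real (Suc b)) \<le> real b / real (Suc b) - 1"
    using assms step by (intro ln_le_minus_one) auto
  hence "1 / real (Suc b) + ln (real b / real a) \<le> ln (real (Suc b) / real a)"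
    using assms step by (simp add: ln_div field_simps)
  finally show ?case by simp
qed

lemma sum_inverse_ge_ln:
  assumes "0 < a" "a \<le> b"
  shows "(\<Sum>v\<in>{a<..b}. 1 / real (v - 1)) \<ge> ln (real b / real a)"
  using assms(2)
proof (induction b rule: dec_induct)
  case base
  show ?case using assms(1) by simp
next
  case (step b)
  have "{a<..Suc b} = insert (Suc b) {a<..b}" using step by auto
  hence "(\<Sum>v\<in>{a<..Suc b}. 1 / real (v - 1))
      = 1 / real b + (\<Sum>v\<in>{a<..b}. 1 / real (v - 1))" by simp
  also have "\<dots> \<ge> 1 / real b + ln (real b / real a)" using step by simp
  moreover have "ln (real (Suc b) / real b) \<le> real (Suc b) / real b - 1"
    using assms step by (intro ln_le_minus_one) auto
  hence "1 / real b + ln (real b / real a) \<ge> ln (real (Suc b) / real a)"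
    using assms step by (simp add: ln_div field_simps)
  ultimately show ?case by simp
qed

section \<open>Chains that climb at constant speed\<close>

definition block :: "nat \<Rightarrow> nat \<Rightarrow> nat set" where
  "block A j = {A ^ j<..A ^ Suc j}"

definition block_family :: "nat \<Rightarrow> nat \<Rightarrow> nat \<Rightarrow> nat \<Rightarrow> nat set set" where
  "block_family A q i r =
     {S. S \<subseteq> {A ^ i<..A ^ (i + r)} \<and> (\<forall>j\<in>{i..<i + r}. card (S \<inter> block A j) = q)}"

lemma finite_block_family: "finite (block_family A q i r)"
  by (rule finite_subset[of _ "Pow {A ^ i<..A ^ (i + r)}"]) (auto simp: block_family_def)

lemma card_block_family_tail:
  assumes S: "S \<in> block_family A q i r" and A: "A \<ge> 2" and "m \<le> r"
  shows "card {u\<in>S. A ^ (i + r - m) < u} = m * q"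
  using \<open>m \<le> r\<close>
proof (induction m)
  case 0
  have "{u\<in>S. A ^ (i + r) < u} = {}" using S by (auto simp: block_family_def)
  thus ?case by (simp only: diff_zero card.empty mult_0)
next
  case (Suc m)
  define j where "j = i + r - Suc m"
  have j: "Suc j = i + r - m" "j \<in> {i..<i + r}" using Suc.prems by (auto simp: j_def)
  have fin: "finite S" using S finite_subset by (fastforce simp: block_family_def)
  have mono: "A ^ j \<le> A ^ Suc j" using A by (intro power_increasing) auto
  hence "A ^ j < u \<longleftrightarrow> (A ^ j < u \<and> u \<le> A ^ Suc j) \<or> A ^ Suc j < u" for u by linarith
  hence "{u\<in>S. A ^ j < u} = (S \<inter> block A j) \<union> {u\<in>S. A ^ Suc j < u}"
    unfolding block_def greaterThanAtMost_iff[symmetric] by blast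
  moreover have "card ((S \<inter> block A j) \<union> {u\<in>S. A ^ Suc j < u})
      = card (S \<inter> block A j) + card {u\<in>S. A ^ Suc j < u}"
    using fin by (intro card_Un_disjoint) (auto simp: block_def)
  moreover have "card (S \<inter> block A j) = q" using S j(2) unfolding block_family_def by blast
  moreover have "card {u\<in>S. A ^ Suc j < u} = m * q" using Suc unfolding j(1) by simp
  ultimately show ?case unfolding j_def[symmetric] by simp
qed

lemma card_block_family:
  assumes "S \<in> block_family A q i r" "A \<ge> 2"
  shows "card S = r * q"
proof -
  have "{u\<in>S. A ^ i < u} = S" using assms by (auto simp: block_family_def)
  thus ?thesis using card_block_family_tail[OF assms, of r] by simp
qed

text \<open>
  A chain of the family is chosen independently in each block, so the total weight is a product
  over the blocks.
\<close>

lemma sum_weight_block_family_ge: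
  assumes A: "A \<ge> 2" and "c \<ge> 0"
    and c: "\<And>j. j \<ge> i \<Longrightarrow> c \<le> (\<Sum>R | R \<subseteq> block A j \<and> card R = q. weight R)"
  shows "c ^ r \<le> (\<Sum>S\<in>block_family A q i r. weight S)"
proof (induction r)
  case 0
  have "block_family A q i 0 = {{}}" by (auto simp: block_family_def)
  thus ?case by (simp add: weight_def)
next
  case (Suc r)
  define G where "G = {R. R \<subseteq> block A (i + r) \<and> card R = q}"
  have finG: "finite G"
    unfolding G_def by (rule finite_subset[of _ "Pow (block A (i + r))"]) (auto simp: block_def)
  have mono: "A ^ a \<le> A ^ b" if "a \<le> b" for a b using A that by (intro power_increasing) auto
  have disj: "S \<inter> block A (i + r) = {}" "R \<inter> {..A ^ (i + r)} = {}" "S \<subseteq> {..A ^ (i + r)}"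
    "R \<subseteq> block A (i + r)"
    if "S \<in> block_family A q i r" "R \<in> G" for S R
    using that by (auto simp: block_family_def G_def block_def)
  have inj: "inj_on (\<lambda>(S, R). S \<union> R) (block_family A q i r \<times> G)"
  proof (rule inj_onI, clarify)
    fix S R S' R'
    assume *: "S \<in> block_family A q i r" "R \<in> G" "S' \<in> block_family A q i r" "R' \<in> G"
      "S \<union> R = S' \<union> R'"
    have "S = (S \<union> R) \<inter> {..A ^ (i + r)}" using disj[OF *(1,2)] by blast
    also have "\<dots> = S'" unfolding *(5) using disj[OF *(3,4)] by blast
    finally have S: "S = S'" .
    have "R = (S \<union> R) \<inter> block A (i + r)" using disj[OF *(1,2)] by blast
    also have "\<dots> = R'" unfolding *(5) using disj[OF *(3,4)] by blast
    finally show "S = S' \<and> R = R'" using S by blast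
  qed
  have maps: "(\<lambda>(S, R). S \<union> R) ` (block_family A q i r \<times> G) \<subseteq> block_family A q i (Suc r)"
  proof clarify
    fix S R assume *: "S \<in> block_family A q i r" "R \<in> G"
    have "S \<subseteq> {A ^ i<..A ^ (i + Suc r)}"
    proof -
      have "{A ^ i<..A ^ (i + r)} \<subseteq> {A ^ i<..A ^ (i + Suc r)}"
        using mono[of "i + r" "i + Suc r"] by (intro Ioc_subset_iff[THEN iffD2]) simp
      thus ?thesis using *(1) unfolding block_family_def by blast
    qed
    moreover have "R \<subseteq> {A ^ i<..A ^ (i + Suc r)}"
    proof -
      have "block A (i + r) \<subseteq> {A ^ i<..A ^ (i + Suc r)}"
        unfolding block_def using mono[of i "i + r"]
        by (intro Ioc_subset_iff[THEN iffD2]) simp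
      thus ?thesis using disj(4)[OF *] by blast
    qed
    moreover have "card ((S \<union> R) \<inter> block A j) = q" if j: "j \<in> {i..<i + Suc r}" for j
    proof (cases "j = i + r")
      case True
      have "(S \<union> R) \<inter> block A j = R" using disj[OF *] True by blast
      thus ?thesis using *(2) by (simp add: G_def)
    next
      case False
      hence "Suc j \<le> i + r" using j by auto
      hence "block A j \<subseteq> {..A ^ (i + r)}" using mono[of "Suc j" "i + r"] by (auto simp: block_def)
      hence "(S \<union> R) \<inter> block A j = S \<inter> block A j" using disj(2)[OF *] by blast
      thus ?thesis using *(1) False j by (auto simp: block_family_def)
    qed
    ultimately show "S \<union> R \<in> block_family A q i (Suc r)" unfolding block_family_def by blast
  qed
  have "c ^ Suc r \<le> (\<Sum>S\<in>block_family A q i r. weight S) * (\<Sum>R\<in>G. weight R)"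
    using Suc.IH c[of "i + r"] \<open>c \<ge> 0\<close> unfolding G_def power_Suc2
    by (intro mult_mono) (auto intro: sum_nonneg)
  also have "\<dots> = (\<Sum>(S, R)\<in>block_family A q i r \<times> G. weight S * weight R)"
    by (simp add: sum_product sum.cartesian_product)
  also have "\<dots> = (\<Sum>(S, R)\<in>block_family A q i r \<times> G. weight (S \<union> R))"
  proof (intro sum.cong refl, clarify)
    fix S R assume *: "S \<in> block_family A q i r" "R \<in> G"
    have "finite S" "finite R"
      using disj(3,4)[OF *] by (auto simp: block_def intro: finite_subset)
    thus "weight S * weight R = weight (S \<union> R)"
      unfolding weight_def using disj[OF *] by (subst prod.union_disjoint) blast+
  qed
  also have "\<dots> = (\<Sum>T\<in>(\<lambda>(S, R). S \<union> R) ` (block_family A q i r \<times> G). weight T)"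
    by (subst sum.reindex[OF inj]) (simp add: case_prod_unfold)
  also have "\<dots> \<le> (\<Sum>T\<in>block_family A q i (Suc r). weight T)"
    by (intro sum_mono2 maps finite_block_family) auto
  finally show ?case .
qed

lemma sum_weight_block_ge:
  assumes A: "A \<ge> 2" and "j \<ge> i" and small: "real q / real A ^ i \<le> ln (real A)"
  shows "(ln (real A) - real q / real A ^ i) ^ q / fact q
       \<le> (\<Sum>R | R \<subseteq> block A j \<and> card R = q. weight R)"
proof -
  define w :: "nat \<Rightarrow> real" where "w v = 1 / real (v - 1)" for v
  have pos: "A ^ j > 0" using A by simp
  have mono: "A ^ i \<le> A ^ j" "A ^ j \<le> A ^ Suc j"
    using A \<open>j \<ge> i\<close> by (auto intro!: power_increasing)
  have "ln (real A) = ln (real (A ^ Suc j) / real (A ^ j))" using A by simp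
  also have "\<dots> \<le> sum w (block A j)"
    unfolding w_def block_def by (rule sum_inverse_ge_ln[OF pos mono(2)])
  finally have W: "ln (real A) \<le> sum w (block A j)" .
  have w: "0 \<le> w v \<and> w v \<le> 1 / real A ^ i" if "v \<in> block A j" for v
  proof -
    have "A ^ i \<le> v - 1" using that mono(1) by (auto simp: block_def)
    hence "real A ^ i \<le> real (v - 1)" by (metis of_nat_le_iff of_nat_power)
    moreover have "real A ^ i > 0" using A by simp
    ultimately show ?thesis unfolding w_def by (auto intro: frac_le)
  qed
  have "(ln (real A) - real q / real A ^ i) ^ q / fact q
      \<le> (sum w (block A j) - real q * (1 / real A ^ i)) ^ q / fact q"
    using W small by (intro divide_right_mono power_mono) auto
  also have "\<dots> \<le> (\<Sum>R | R \<subseteq> block A j \<and> card R = q. prod w R)"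
    using w W small by (intro sum_card_subsets_prod_ge) (auto simp: block_def)
  finally show ?thesis unfolding weight_def w_def .
qed

text \<open>
  Suppose that a branch leaves \<open>S\<close> in a block followed by \<open>m\<close> further blocks.  It uses weights of
  total at most \<open>(m + 1) ln A\<close> and has at least \<open>m q\<close> elements.  The exponential Markov inequality
  with the optimal parameter \<open>z = e\<close> bounds the weight of such branches by
  \<open>exp (e (m + 1) ln A - m q) \<le> exp q\<close>, because \<open>e ln A \<le> q\<close>.  A branch that leaves at the root
  costs one more summand \<open>e\<close> in the exponent, since the first element of the first block,
  whose weight \<open>1 / A ^ i\<close> is only known to be at most \<open>1\<close>, is then available too.
\<close>

lemma block_family_tail_weight_le:
  assumes A: "A \<ge> 2" and q: "exp 1 * ln (real A) \<le> real q" and r: "r \<ge> 1"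
    and S: "S \<in> block_family A q i r" and t: "t \<in> insert 1 S"
  shows "(\<Sum>R | R \<subseteq> {v\<in>{A ^ i<..A ^ (i + r)}. t < v} \<and> card R = card {u\<in>S. t < u}. weight R)
       \<le> exp (exp 1 + real q)"
proof -
  define w :: "nat \<Rightarrow> real" where "w v = 1 / real (v - 1)" for v
  define X where "X = {v\<in>{A ^ i<..A ^ (i + r)}. t < v}"
  have finX: "finite X" by (simp add: X_def)
  have w_nn: "w v \<ge> 0" for v by (simp add: w_def)
  have mono: "A ^ a \<le> A ^ b" if "a \<le> b" for a b using A that by (intro power_increasing) auto
  have finS: "finite S" using S finite_subset by (fastforce simp: block_family_def)
  have S_sub: "S \<subseteq> {A ^ i<..A ^ (i + r)}" using S by (auto simp: block_family_def)
  have sum_le: "(\<Sum>v\<in>{Suc (A ^ j)<..A ^ (i + r)}. w v) \<le> real m * ln (real A)"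
    if jm: "j + m = i + r" "m \<ge> 1" for j m
  proof -
    have less: "A ^ j < A ^ (i + r)" using A jm by (intro power_strict_increasing) auto
    then obtain b where b: "A ^ (i + r) = Suc b" "A ^ j \<le> b"
      by (metis Suc_le_eq Suc_pred less_Suc_eq_le less_imp_Suc_add not_less_zero zero_less_iff_neq_zero)
    have "(\<Sum>v\<in>{Suc (A ^ j)<..Suc b}. w v) \<le> ln (real b / real (A ^ j))"
      unfolding w_def using A b by (intro sum_inverse_le_ln) auto
    also have "\<dots> \<le> ln (real (A ^ (i + r)) / real (A ^ j))"
    proof -
      have "real b > 0" using b(2) A by (metis gr0I le_zero_eq not_numeral_le_zero of_nat_0_less_iff power_eq_0_iff)
      thus ?thesis using A b by (subst ln_le_cancel_iff) (auto intro!: divide_right_mono)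
    qed
    also have "real (A ^ (i + r)) / real (A ^ j) = real A ^ m"
      using A unfolding jm(1)[symmetric] by (simp add: power_add)
    also have "ln (real A ^ m) = real m * ln (real A)" using A by (simp add: ln_realpow)
    finally show ?thesis unfolding b(1) .
  qed
  have chernoff: "(\<Sum>R | R \<subseteq> X \<and> card R = card {u\<in>S. t < u}. weight R)
      \<le> exp (exp 1 * sum w X - real k)" if "k \<le> card {u\<in>S. t < u}" for k
  proof -
    have "(\<Sum>R | R \<subseteq> X \<and> card R = card {u\<in>S. t < u}. prod w R) \<le> exp (exp 1 * sum w X) / exp 1 ^ k"
      using that finX w_nn by (intro sum_large_subsets_prod_le) auto
    thus ?thesis unfolding weight_def w_def by (simp add: exp_diff exp_of_nat_mult[symmetric])
  qed
  show ?thesis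
  proof (cases "t = 1")
    case True
    have "A ^ i \<ge> 1" using A by simp
    hence "{u\<in>S. t < u} = S" using S_sub True by fastforce
    hence "card {u\<in>S. t < u} = r * q" using card_block_family[OF S A] by simp
    hence bound: "(\<Sum>R | R \<subseteq> X \<and> card R = card {u\<in>S. t < u}. weight R)
        \<le> exp (exp 1 * sum w X - real (r * q))"
      by (intro chernoff) simp
    have "sum w X \<le> 1 + real r * ln (real A)"
    proof -
      have "sum w X \<le> sum w (insert (Suc (A ^ i)) {Suc (A ^ i)<..A ^ (i + r)})"
        using w_nn by (intro sum_mono2) (auto simp: X_def)
      also have "\<dots> = 1 / real (A ^ i) + (\<Sum>v\<in>{Suc (A ^ i)<..A ^ (i + r)}. w v)"
        by (simp add: w_def)
      also have "\<dots> \<le> 1 + real r * ln (real A)"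
      proof (intro add_mono sum_le)
        show "1 / real (A ^ i) \<le> 1"
          using A by (simp add: divide_le_eq_1)
      qed (use r in auto)
      finally show ?thesis .
    qed
    hence "exp 1 * sum w X \<le> exp 1 * (1 + real r * ln (real A))"
      by (rule mult_left_mono) simp
    also have "\<dots> = exp 1 + real r * (exp 1 * ln (real A))" by (simp add: algebra_simps)
    also have "\<dots> \<le> exp 1 + real r * real q"
      using q by (intro add_mono mult_left_mono) auto
    finally have "exp (exp 1 * sum w X - real (r * q)) \<le> exp (exp 1 + real q)"
      by simp
    with bound show ?thesis unfolding X_def by (rule order.trans)
  next
    case False
    hence tS: "t \<in> S" using t by simp
    define j where "j = (LEAST j. t \<le> A ^ Suc j)"
    have "Suc (i + r - 1) = i + r" using r by simp
    hence "t \<le> A ^ Suc (i + r - 1)" using tS S_sub by auto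
    hence j: "t \<le> A ^ Suc j" "j \<le> i + r - 1"
      unfolding j_def by (auto intro: LeastI Least_le)
    have j2: "A ^ j < t"
    proof (cases j)
      case 0
      have "A ^ i \<ge> 1" using A by simp
      moreover have "A ^ i < t" using S_sub tS by auto
      ultimately show ?thesis using 0 by simp
    next
      case (Suc k)
      hence "\<not> t \<le> A ^ Suc k" unfolding j_def by (intro not_less_Least) simp
      thus ?thesis using Suc by simp
    qed
    have ij: "i \<le> j"
    proof (rule ccontr)
      assume "\<not> i \<le> j"
      hence "A ^ Suc j \<le> A ^ i" by (intro mono) auto
      moreover have "A ^ i < t" using S_sub tS by auto
      ultimately show False using j(1) by linarith
    qed
    define m where "m = i + r - Suc j"
    have m: "Suc j = i + r - m" "m \<le> r" "j + Suc m = i + r" using j(2) ij r by (auto simp: m_def)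
    have "m * q = card {u\<in>S. A ^ Suc j < u}"
      unfolding m(1) using card_block_family_tail[OF S A m(2)] by simp
    also have "\<dots> \<le> card {u\<in>S. t < u}"
      using finS j(1) by (intro card_mono) auto
    finally have bound: "(\<Sum>R | R \<subseteq> X \<and> card R = card {u\<in>S. t < u}. weight R)
        \<le> exp (exp 1 * sum w X - real (m * q))" by (rule chernoff)
    have "sum w X \<le> sum w {Suc (A ^ j)<..A ^ (i + r)}"
      using w_nn j2 by (intro sum_mono2) (auto simp: X_def)
    hence "sum w X \<le> real (Suc m) * ln (real A)"
      using sum_le[of j "Suc m"] m(3) by linarith
    hence "exp 1 * sum w X \<le> exp 1 * (real (Suc m) * ln (real A))"
      by (rule mult_left_mono) simp
    also have "\<dots> = real (Suc m) * (exp 1 * ln (real A))" by (simp only: mult_ac)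
    also have "\<dots> \<le> real (Suc m) * real q"
      using q by (intro mult_left_mono) auto
    also have "\<dots> = real q + real (m * q)" by (simp add: distrib_right)
    finally have "exp 1 * sum w X - real (m * q) \<le> exp 1 + real q"
      using exp_gt_zero[of "1::real"] by linarith
    hence "exp (exp 1 * sum w X - real (m * q)) \<le> exp (exp 1 + real q)" by simp
    with bound show ?thesis unfolding X_def by (rule order.trans)
  qed
qed

section \<open>Bounds on the tail of the height\<close>

lemma prob_height_eq:
  assumes "n \<ge> 1"
  shows "measure_pmf.prob (random_recursive_tree n) {E. h \<le> height n E}
       = measure_pmf.prob (parent_map_pmf n) (\<Union>S\<in>{S. S \<subseteq> {2..n} \<and> h \<le> card S}. {p. chain S p})"
proof -
  obtain m where m: "n = Suc m" using assms by (cases n) auto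
  have "measure_pmf.prob (random_recursive_tree n) {E. h \<le> height n E}
      = measure_pmf.prob (parent_map_pmf n) {p. h \<le> height n (tree_of_parents n p)}"
    unfolding m random_recursive_tree_eq_parent_map by simp
  also have "\<dots> = measure_pmf.prob (parent_map_pmf n)
      (\<Union>S\<in>{S. S \<subseteq> {2..n} \<and> h \<le> card S}. {p. chain S p})"
  proof (rule measure_pmf.finite_measure_eq_AE)
    show "AE p in measure_pmf (parent_map_pmf n). p \<in> {p. h \<le> height n (tree_of_parents n p)} \<longleftrightarrow>
        p \<in> (\<Union>S\<in>{S. S \<subseteq> {2..n} \<and> h \<le> card S}. {p. chain S p})"
      using le_height_iff_chain[OF parent_map_if_mem_set_pmf assms]
      by (intro AE_pmfI) auto
  qed auto
  finally show ?thesis .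
qed

lemma prob_height_ge_lower:
  assumes A: "A \<ge> 2" and q: "exp 1 * ln (real A) \<le> real q" and r: "r \<ge> 1"
    and small: "real q / real A ^ i \<le> ln (real A)" and n: "A ^ (i + r) \<le> n" and h: "h \<le> r * q"
  shows "((ln (real A) - real q / real A ^ i) ^ q / fact q) ^ r
         / (real (r * q + 1) * exp (exp 1 + real q))
       \<le> measure_pmf.prob (random_recursive_tree n) {E. h \<le> height n E}"
proof -
  define c where "c = (ln (real A) - real q / real A ^ i) ^ q / fact q"
  define B where "B = real (r * q + 1) * exp (exp 1 + real q)"
  define F where "F = block_family A q i r"
  have B: "B > 0" unfolding B_def by (intro mult_pos_pos) (auto simp: add_pos_nonneg)
  have "A ^ i \<ge> 1" "A ^ (i + r) \<ge> 1" using A by simp_all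
  hence n1: "n \<ge> 1" and V: "{A ^ i<..A ^ (i + r)} \<subseteq> {2..n}" using n by auto
  have sub: "S \<subseteq> {A ^ i<..A ^ (i + r)} \<and> card S = r * q" if "S \<in> F" for S
  proof
    show "S \<subseteq> {A ^ i<..A ^ (i + r)}" using that unfolding F_def block_family_def by blast
    show "card S = r * q" using that unfolding F_def by (rule card_block_family[OF _ A])
  qed
  have "c ^ r \<le> (\<Sum>S\<in>F. weight S)"
    unfolding F_def c_def using small A
    by (intro sum_weight_block_family_ge sum_weight_block_ge) auto
  also have "\<dots> = (\<Sum>S\<in>F. measure_pmf.prob (parent_map_pmf n) {p. chain S p})"
    using sub V by (intro sum.cong refl prob_chain[symmetric]) blast
  finally have "c ^ r / B \<le> (\<Sum>S\<in>F. measure_pmf.prob (parent_map_pmf n) {p. chain S p}) / B"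
    using B by (intro divide_right_mono) auto
  also have "\<dots> \<le> measure_pmf.prob (parent_map_pmf n) (\<Union>S\<in>F. {p. chain S p})"
  proof (rule prob_union_ge_second_moment[OF _ B])
    show "finite F" unfolding F_def by (rule finite_block_family)
    show "(\<Sum>S'\<in>F. measure_pmf.prob (parent_map_pmf n) ({p. chain S p} \<inter> {p. chain S' p}))
        \<le> B * measure_pmf.prob (parent_map_pmf n) {p. chain S p}" if S: "S \<in> F" for S
      unfolding B_def
      by (rule sum_prob_two_chains_le[OF V sub S
            block_family_tail_weight_le[OF A q r S[unfolded F_def]]])
  qed
  also have "\<dots> \<le> measure_pmf.prob (random_recursive_tree n) {E. h \<le> height n E}"
  proof -
    have "F \<subseteq> {S. S \<subseteq> {2..n} \<and> h \<le> card S}" using sub V h by fastforce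
    hence "(\<Union>S\<in>F. {p. chain S p}) \<subseteq> (\<Union>S\<in>{S. S \<subseteq> {2..n} \<and> h \<le> card S}. {p. chain S p})"
      by blast
    thus ?thesis
      unfolding prob_height_eq[OF n1] by (intro measure_pmf.finite_measure_mono) auto
  qed
  finally show ?thesis by (simp add: c_def B_def)
qed

text \<open>
  The expected number of chains with at least \<open>h\<close> elements.
\<close>

lemma prob_height_ge_upper:
  assumes n: "n \<ge> 1" and y: "y \<ge> 1"
  shows "measure_pmf.prob (random_recursive_tree n) {E. h \<le> height n E}
       \<le> exp (y * (1 + ln (real n))) / y ^ h"
proof -
  define w :: "nat \<Rightarrow> real" where "w v = 1 / real (v - 1)" for v
  define F where "F = {S. S \<subseteq> {2..n} \<and> h \<le> card S}"
  have finF: "finite F"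
    by (rule finite_subset[of _ "Pow {2..n}"]) (auto simp: F_def)
  have "measure_pmf.prob (parent_map_pmf n) (\<Union>S\<in>F. {p. chain S p})
      \<le> (\<Sum>S\<in>F. measure_pmf.prob (parent_map_pmf n) {p. chain S p})"
    using finF by (intro measure_pmf.finite_measure_subadditive_finite) auto
  also have "\<dots> = (\<Sum>S\<in>F. prod w S)"
    using prob_chain[unfolded weight_def] unfolding w_def F_def by (intro sum.cong) auto
  also have "\<dots> \<le> exp (y * sum w {2..n}) / y ^ h"
    using y by (intro sum_large_subsets_prod_le) (auto simp: w_def F_def)
  also have "\<dots> \<le> exp (y * (1 + ln (real n))) / y ^ h"
  proof -
    have "sum w {2..n} \<le> 1 + ln (real n)"
    proof (cases "n = 1")
      case False
      then obtain b where b: "n = Suc b" "1 \<le> b" using n by (cases n) auto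
      have "{2..n} = insert 2 {Suc 1<..Suc b}" using b by auto
      hence "sum w {2..n} = 1 + sum w {Suc 1<..Suc b}" by (simp add: w_def)
      also have "\<dots> \<le> 1 + ln (real b / real 1)"
        unfolding w_def using b by (intro add_left_mono sum_inverse_le_ln) auto
      also have "\<dots> \<le> 1 + ln (real n)" using b by simp
      finally show ?thesis .
    qed auto
    thus ?thesis using y by (intro divide_right_mono) auto
  qed
  finally show ?thesis unfolding prob_height_eq[OF n] F_def .
qed

section \<open>The exponential rate\<close>

text \<open>
  With \<open>L = ln A\<close> and \<open>q\<close> equal to \<open>y L\<close> up to rounding, where \<open>y = \<beta> e\<close>, Stirling's estimate gives
  \<open>- ln (L ^ q / fact q) = q (ln (q / L) - 1) + O(ln q)\<close>, and this is \<open>(y ln y - y) L = J \<beta> L\<close> up to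
  lower order terms as \<open>A\<close> grows.  The correction \<open>q / A ^ i\<close> disappears when \<open>i\<close> grows for
  fixed \<open>A\<close> and \<open>q\<close>.
\<close>

lemma ex_block_parameters:
  fixes \<beta> a :: real
  assumes "\<beta> > 1" and a: "a > J \<beta>"
  obtains A q i :: nat where "A \<ge> 2" "\<beta> * exp 1 * ln (real A) \<le> real q"
    "real q / real A ^ i < ln (real A)"
    "- ln ((ln (real A) - real q / real A ^ i) ^ q / fact q) \<le> a * ln (real A)"
proof -
  define y where "y = \<beta> * exp 1"
  have y: "y > 0" "ln y = ln \<beta> + 1" using assms(1) by (auto simp: y_def ln_mult)
  \<comment> \<open>The bound obtained below for \<open>- ln (L ^ q / fact q) / L\<close>, with \<open>q\<close> replaced by \<open>y L + 1\<close>.\<close>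
  define g where "g L = (1 + ln (y * L + 1) + (y * L + 1) * (ln (y * L + 1) - 1 - ln L)) / L" for L
  have "(g \<longlongrightarrow> y * (ln y - 1)) at_top"
    unfolding g_def using y(1) by real_asymp
  hence "((\<lambda>A. g (ln (real A))) \<longlongrightarrow> y * (ln y - 1)) at_top"
    by (rule filterlim_compose[OF _ filterlim_compose[OF ln_at_top filterlim_real_sequentially]])
  moreover have "y * (ln y - 1) < a" using a y by (simp add: J_def y_def mult_ac)
  ultimately have "eventually (\<lambda>A. g (ln (real A)) < a) sequentially" by (rule order_tendstoD)
  hence "eventually (\<lambda>A. g (ln (real A)) < a \<and> A \<ge> 2) sequentially"
    by (intro eventually_conj eventually_ge_at_top)
  then obtain A where A: "A \<ge> 2" "g (ln (real A)) < a"
    using eventually_happens'[OF sequentially_bot] by blast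
  define L where "L = ln (real A)"
  define q where "q = nat \<lceil>y * L\<rceil>"
  have L: "L > 0" using A by (simp add: L_def)
  have "y * L > 0" using L y by simp
  hence q: "y * L \<le> real q" "real q \<le> y * L + 1" "q \<ge> 1"
    unfolding q_def by linarith+
  \<comment> \<open>Needed because this factor multiplies \<open>q\<close>, which is then bounded from above.\<close>
  have slope: "0 \<le> ln (real q) - 1 - ln L"
  proof -
    have "ln (y * L) \<le> ln (real q)" using q \<open>y * L > 0\<close> by simp
    moreover have "ln (y * L) = ln \<beta> + 1 + ln L" using L y by (simp add: ln_mult)
    moreover have "ln \<beta> \<ge> 0" using assms by simp
    ultimately show ?thesis by linarith
  qed
  have lnq: "ln (real q) \<le> ln (y * L + 1)" using q by simp
  have "- ln (L ^ q / fact q) = ln (fact q) - real q * ln L"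
    using L by (simp add: ln_div ln_realpow)
  also have "ln (fact q) \<le> ln (exp 1 * real q * (real q / exp 1) ^ q)"
    using fact_le_stirling[OF q(3)] q(3) by simp
  also have "\<dots> = 1 + ln (real q) + real q * (ln (real q) - 1)"
    using q(3) by (simp add: ln_mult ln_realpow ln_div)
  also have "1 + ln (real q) + real q * (ln (real q) - 1) - real q * ln L
      = 1 + ln (real q) + real q * (ln (real q) - 1 - ln L)" by (simp add: algebra_simps)
  also have "\<dots> \<le> 1 + ln (y * L + 1) + (y * L + 1) * (ln (y * L + 1) - 1 - ln L)"
    using lnq slope q \<open>y * L > 0\<close> by (intro add_mono mult_mono) auto
  also have "\<dots> = g L * L" using L by (simp add: g_def)
  also have "\<dots> < a * L" using A L by (simp add: L_def)
  finally have less: "- ln (L ^ q / fact q) < a * L" by simp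
  have lim0: "(\<lambda>i. real q / real A ^ i) \<longlonglongrightarrow> 0"
    using A by real_asymp
  have "(\<lambda>i. - ln ((L - real q / real A ^ i) ^ q / fact q)) \<longlonglongrightarrow> - ln ((L - 0) ^ q / fact q)"
    using L by (intro tendsto_intros lim0) auto
  hence "eventually (\<lambda>i. - ln ((L - real q / real A ^ i) ^ q / fact q) < a * L) sequentially"
    using less by (intro order_tendstoD) auto
  moreover have "eventually (\<lambda>i. real q / real A ^ i < L) sequentially"
    using lim0 L by (rule order_tendstoD)
  ultimately have "eventually (\<lambda>i. - ln ((L - real q / real A ^ i) ^ q / fact q) < a * L
      \<and> real q / real A ^ i < L) sequentially" by (rule eventually_conj)
  then obtain i where "- ln ((L - real q / real A ^ i) ^ q / fact q) < a * L"
      "real q / real A ^ i < L"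
    using eventually_happens'[OF sequentially_bot] by blast
  thus ?thesis using A(1) q(1) by (intro that[of A q i]) (auto simp: L_def y_def)
qed

lemma height_ge_real_iff:
  "{E. real (height n E) \<ge> x} = {E. nat \<lceil>x\<rceil> \<le> height n E}"
  by (auto simp: nat_le_iff ceiling_le_iff)

text \<open>
  The blocks are built for a slightly larger \<open>\<beta>'\<close>.  The surplus makes up for the initial \<open>i\<close>
  blocks that are left unused and for the incomplete last block.
\<close>

lemma eventually_rate_less:
  fixes \<beta> a :: real
  assumes \<beta>: "\<beta> > 1" and a: "J \<beta> < a"
  defines "P \<equiv> \<lambda>n. measure_pmf.prob (random_recursive_tree n)
             {E. real (height n E) \<ge> \<beta> * exp 1 * ln (real n)}"
  shows "eventually (\<lambda>n. P n > 0 \<and> - ln (P n) / ln (real n) < a) sequentially"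
proof -
  have "(J \<longlongrightarrow> J \<beta>) (at_right \<beta>)"
    unfolding J_def[abs_def] using \<beta> by (intro tendsto_intros) auto
  hence "eventually (\<lambda>b. J b < a) (at_right \<beta>)" using a by (rule order_tendstoD)
  hence "eventually (\<lambda>b. J b < a \<and> \<beta> < b) (at_right \<beta>)"
    by (intro eventually_conj eventually_at_right_less)
  then obtain \<beta>' where \<beta>': "\<beta>' > \<beta>" "J \<beta>' < a"
    using eventually_happens'[OF trivial_limit_at_right_real] by blast
  obtain a' where a': "J \<beta>' < a'" "a' < a" using dense[OF \<beta>'(2)] by blast
  have "J \<beta>' > 0" using \<beta> \<beta>' by (simp add: J_def)
  hence a'_pos: "a' > 0" using a' by simp
  obtain A q i :: nat where A: "A \<ge> 2" and q: "\<beta>' * exp 1 * ln (real A) \<le> real q"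
    and small: "real q / real A ^ i < ln (real A)"
    and c: "- ln ((ln (real A) - real q / real A ^ i) ^ q / fact q) \<le> a' * ln (real A)"
    using ex_block_parameters[of \<beta>' a'] \<beta> \<beta>' a' by auto
  define c where "c = (ln (real A) - real q / real A ^ i) ^ q / fact q"
  have c_pos: "c > 0" using small by (simp add: c_def)
  define L where "L = ln (real A)"
  have L: "L > 0" using A by (simp add: L_def)
  have qL: "exp 1 * L \<le> real q"
  proof -
    have "1 * (exp 1 * L) \<le> \<beta>' * (exp 1 * L)"
      using \<beta> \<beta>' L by (intro mult_right_mono) auto
    thus ?thesis using q unfolding L_def mult.assoc mult_1 by linarith
  qed
  define g where "g n = (ln (real q / L * ln (real n) + 1) + (exp 1 + real q)) / ln (real n)" for n :: nat
  have "g \<longlonglongrightarrow> 0"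
  proof -
    have "0 < exp 1 * L" using L by simp
    hence "real q / L > 0" using qL L by (intro divide_pos_pos) linarith+
    thus ?thesis unfolding g_def by real_asymp
  qed
  hence ev_g: "eventually (\<lambda>n. g n < a - a') sequentially"
    using a' by (intro order_tendstoD) auto
  \<comment> \<open>From \<open>r0\<close> blocks on, \<open>r\<close> blocks at speed \<open>\<beta>'\<close> reach as high as \<open>i + r + 1\<close> blocks at speed \<open>\<beta>\<close>.\<close>
  obtain r0 :: nat where r0: "\<beta> * (real i + 1) / (\<beta>' - \<beta>) \<le> real r0"
    using real_arch_simple by blast
  have "eventually (\<lambda>n. n \<ge> A ^ (i + r0 + 1)) sequentially" by (rule eventually_ge_at_top)
  with ev_g show ?thesis
  proof eventually_elim
    case (elim n)
    have "A ^ (i + r0 + 1) \<ge> 2 ^ 1" using A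
      by (intro order.trans[OF power_increasing[of 1 "i + r0 + 1" "2::nat"] power_mono]) auto
    hence n2: "n \<ge> 2" using elim by simp
    then obtain k where k: "A ^ k \<le> n" "n < A ^ (k + 1)"
      using ex_power_ivl1[OF A, of n] by auto
    have "A ^ (i + r0 + 1) < A ^ (k + 1)" using k elim by linarith
    hence "i + r0 < k" using A by (subst (asm) power_strict_increasing_iff) auto
    \<comment> \<open>The number of complete blocks used.\<close>
    define r where "r = k - i"
    have r: "k = i + r" "r \<ge> r0" "r \<ge> 1" using \<open>i + r0 < k\<close> by (auto simp: r_def)
    have ln_n: "ln (real n) > 0" using n2 by simp
    have "real n \<le> real A ^ (i + r + 1)"
      using k(2) unfolding r(1) by (metis less_imp_le of_nat_le_iff of_nat_power)
    hence "ln (real n) \<le> ln (real A ^ (i + r + 1))" using n2 by (subst ln_le_cancel_iff) (use A in auto)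
    also have "\<dots> = real (i + r + 1) * L" unfolding L_def by (rule ln_realpow)
    also have "\<dots> = (real i + real r + 1) * L" by simp
    finally have ln_n_le: "ln (real n) \<le> (real i + real r + 1) * L" .
    have rL: "real r * L \<le> ln (real n)"
    proof -
      have "A ^ r \<le> A ^ k" using A r by (intro power_increasing) auto
      hence "real A ^ r \<le> real n" using k(1) by (metis le_trans of_nat_le_iff of_nat_power)
      hence "ln (real A ^ r) \<le> ln (real n)" using A n2 by (subst ln_le_cancel_iff) auto
      thus ?thesis using A by (simp add: ln_realpow L_def)
    qed
    have "\<beta> * (real i + real r + 1) \<le> \<beta>' * real r"
    proof -
      have "\<beta> * (real i + 1) \<le> real r0 * (\<beta>' - \<beta>)"
        using r0 \<beta>' by (simp add: divide_le_eq)
      also have "\<dots> \<le> real r * (\<beta>' - \<beta>)" using r(2) \<beta>' by (intro mult_right_mono) auto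
      finally show ?thesis by (simp add: algebra_simps)
    qed
    hence "\<beta> * (real i + real r + 1) * (exp 1 * L) \<le> \<beta>' * real r * (exp 1 * L)"
      using L by (intro mult_right_mono) auto
    moreover have "\<beta> * exp 1 * ln (real n) \<le> \<beta> * exp 1 * ((real i + real r + 1) * L)"
      using ln_n_le \<beta> by (intro mult_left_mono) auto
    moreover have "real r * (\<beta>' * exp 1 * L) \<le> real r * real q"
      using q by (intro mult_left_mono) (auto simp: L_def)
    ultimately have "\<beta> * exp 1 * ln (real n) \<le> real (r * q)"
      by (simp add: mult_ac)
    hence h: "nat \<lceil>\<beta> * exp 1 * ln (real n)\<rceil> \<le> r * q"
      by (simp add: nat_le_iff ceiling_le_iff)
    have rq: "real (r * q + 1) > 0" by (simp only: of_nat_0_less_iff zero_less_Suc add_gr_0 zero_less_one simp_thms)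
    define D where "D = real (r * q + 1) * exp (exp 1 + real q)"
    have D: "D > 0" unfolding D_def by (rule mult_pos_pos[OF rq exp_gt_zero])
    have P_ge: "c ^ r / D \<le> P n"
      unfolding P_def height_ge_real_iff c_def D_def
      using qL k(1) unfolding r(1) L_def
      by (intro prob_height_ge_lower A r(3) h less_imp_le[OF small])
    have pos: "0 < c ^ r / D" using c_pos D by simp
    hence "P n > 0" using P_ge by linarith
    have "ln (c ^ r / D) \<le> ln (P n)" using P_ge pos by (subst ln_le_cancel_iff) auto
    hence "- ln (P n) \<le> real r * (- ln c) + ln D"
      using c_pos D by (simp add: ln_div ln_realpow)
    also have "real r * (- ln c) \<le> real r * (a' * L)"
      using c by (intro mult_left_mono) (auto simp: c_def L_def)
    also have "\<dots> \<le> a' * ln (real n)"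
      using rL a'_pos by (simp add: mult.left_commute mult_left_mono)
    also have "ln D = ln (real (r * q + 1)) + (exp 1 + real q)"
      unfolding D_def by (subst ln_mult_pos[OF rq exp_gt_zero]) simp
    also have "ln (real (r * q + 1)) \<le> ln (real q / L * ln (real n) + 1)"
    proof -
      have "real r \<le> ln (real n) / L" using rL L by (simp add: field_simps)
      hence "real q * real r \<le> real q * (ln (real n) / L)" by (intro mult_left_mono) auto
      hence le: "real (r * q + 1) \<le> real q / L * ln (real n) + 1" by (simp add: mult_ac)
      with rq show ?thesis by (subst ln_le_cancel_iff) linarith+
    qed
    also have "ln (real q / L * ln (real n) + 1) + (exp 1 + real q) = g n * ln (real n)"
      using ln_n by (simp add: g_def)
    finally have "- ln (P n) \<le> (a' + g n) * ln (real n)" by (simp add: distrib_right)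
    also have "\<dots> < a * ln (real n)" using elim ln_n by (intro mult_strict_right_mono) auto
    finally show ?case using \<open>P n > 0\<close> pos_divide_less_eq[OF ln_n] by blast
  qed
qed

text \<open>
  Positivity of the probability matters here because the logarithm of \<open>0\<close> has the value \<open>0\<close>.
\<close>

lemma rate_ge:
  fixes \<beta> :: real
  assumes \<beta>: "\<beta> > 1" and n: "n \<ge> 2"
  defines "P \<equiv> measure_pmf.prob (random_recursive_tree n)
             {E. real (height n E) \<ge> \<beta> * exp 1 * ln (real n)}"
  assumes pos: "P > 0"
  shows "J \<beta> - \<beta> * exp 1 / ln (real n) \<le> - ln P / ln (real n)"
proof -
  define y where "y = \<beta> * exp 1"
  define L where "L = ln (real n)"
  define h where "h = nat \<lceil>y * L\<rceil>"
  have y: "y > 1" "ln y = ln \<beta> + 1"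
    using \<beta> by (auto simp: y_def ln_mult intro!: less_1_mult)
  have L: "L > 0" using n by (simp add: L_def)
  have h: "y * L \<le> real h" unfolding h_def by linarith
  have "P \<le> exp (y * (1 + L)) / y ^ h"
    unfolding P_def height_ge_real_iff h_def L_def y_def[symmetric]
    using n y by (intro prob_height_ge_upper) auto
  hence "ln P \<le> ln (exp (y * (1 + L)) / y ^ h)" using pos by simp
  also have "\<dots> = y * (1 + L) - real h * ln y" using y by (simp add: ln_div ln_realpow)
  also have "\<dots> \<le> y * (1 + L) - y * L * ln y"
    using h y \<beta> by (intro diff_left_mono mult_right_mono) auto
  also have "\<dots> = y - J \<beta> * L" unfolding y(2) by (simp add: J_def y_def algebra_simps)
  finally have "J \<beta> * L - y \<le> - ln P" by simp
  hence "(J \<beta> * L - y) / L \<le> - ln P / L" using L by (intro divide_right_mono) auto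
  thus ?thesis using L by (simp add: diff_divide_distrib y_def L_def)
qed

theorem theorem1p2:
  fixes \<beta> :: real
  assumes "\<beta> > 1"
  shows "(\<lambda>n::nat. - ln (measure_pmf.prob (random_recursive_tree n)
             {E. real (height n E) \<ge> \<beta> * exp 1 * ln (real n)}) / ln (real n))
           \<longlonglongrightarrow> J \<beta>"
proof (rule order_tendstoI)
  fix a assume "a > J \<beta>"
  from eventually_rate_less[OF assms this]
  show "\<forall>\<^sub>F n in sequentially. - ln (measure_pmf.prob (random_recursive_tree n)
             {E. real (height n E) \<ge> \<beta> * exp 1 * ln (real n)}) / ln (real n) < a"
    by (rule eventually_mono) simp
next
  fix a assume a: "a < J \<beta>"
  have "(\<lambda>n. J \<beta> - \<beta> * exp 1 / ln (real n)) \<longlonglongrightarrow> J \<beta>" by real_asymp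
  hence "eventually (\<lambda>n. a < J \<beta> - \<beta> * exp 1 / ln (real n)) sequentially"
    using a by (rule order_tendstoD)
  moreover have "eventually (\<lambda>n. 0 < measure_pmf.prob (random_recursive_tree n)
             {E. real (height n E) \<ge> \<beta> * exp 1 * ln (real n)}) sequentially"
    using eventually_rate_less[OF assms, of "J \<beta> + 1"] by (rule eventually_mono) simp_all
  moreover have "eventually (\<lambda>n::nat. n \<ge> 2) sequentially" by (rule eventually_ge_at_top)
  ultimately show "\<forall>\<^sub>F n in sequentially. a < - ln (measure_pmf.prob (random_recursive_tree n)
             {E. real (height n E) \<ge> \<beta> * exp 1 * ln (real n)}) / ln (real n)"
    by eventually_elim (use rate_ge[OF assms] in force)
qed

end
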